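(* Let $K\ge 2$ be an integer and let $X$ be $\mathbb{R}^2$ equipped with a norm $\|\cdot\|_X$ whose closed unit ball $BX=\{x\in\mathbb{R}^2:\|x\|_X\le 1\}$ is a symmetric convex polygon with $2K$ sides. Then there is a set $E\subset[0,1]^2$ with Hausdorff dimension $\ge K/(K-1)$ such that the one-dimensional Lebesgue measure of $\Delta_X(E)$ is $0$.
   Context: For $E\subset X$, the $X$-distance set of $E$ is $\Delta_X(E)=\{\|x-x'\|_X: x,x'\in E\}\subset[0,\infty)$. *)

theory Defs
  imports "HOL-Analysis.Analysis"
begin

definition is_norm :: "('a::real_vector \<Rightarrow> real) \<Rightarrow> bool" where
  "is_norm N \<longleftrightarrow>
     (\<forall>x. N x = 0 \<longrightarrow> x = 0) \<and>
     (\<forall>x y. N (x + y) \<le> N x + N y) \<and>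
     (\<forall>c x. N (c *\<^sub>R x) = \<bar>c\<bar> * N x)"

definition distance_set :: "('a::real_vector \<Rightarrow> real) \<Rightarrow> 'a set \<Rightarrow> real set" where
  "distance_set N E = {N (x - x') | x x'. x \<in> E \<and> x' \<in> E}"

definition hausdorff_pre :: "real \<Rightarrow> real \<Rightarrow> 'a::metric_space set \<Rightarrow> ennreal" where
  "hausdorff_pre s \<delta> E =
     (INF C \<in> {C :: nat \<Rightarrow> 'a set. E \<subseteq> (\<Union>n. C n) \<and> (\<forall>n. bounded (C n) \<and> diameter (C n) \<le> \<delta>)}.
        (\<Sum>n. ennreal (diameter (C n) powr s)))"

definition hausdorff_outer :: "real \<Rightarrow> 'a::metric_space set \<Rightarrow> ennreal" where
  "hausdorff_outer s E = (SUP \<delta> \<in> {0<..}. hausdorff_pre s \<delta> E)"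

definition hausdorff_dim :: "'a::metric_space set \<Rightarrow> real" where
  "hausdorff_dim E = Inf {s. s \<ge> 0 \<and> hausdorff_outer s E = 0}"

end

theory Submission
  imports Defs
begin

text \<open>A polygonal norm is at every point one of finitely many linear functionals, so it suffices to
  find \<open>E\<close> of dimension \<open>2\<close> (at least \<open>K / (K - 1)\<close>) whose difference set has a null image under
  each of them. Take a sequence of functionals \<open>\<pi>\<^sub>k\<close> in which each one recurs infinitely often, and
  a rapidly refined nested family of dyadic squares; in step \<open>k\<close> keep only the subsquares, of side \<open>1 / M\<close>,
  in which \<open>M \<pi>\<^sub>k\<close> is within a bounded distance of \<open>2\<^sup>k \<int>\<close>. Then \<open>\<pi>\<^sub>k (E - E)\<close> has measure \<open>O(2\<^sup>-\<^sup>k)\<close>.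
  Every kept square keeps exactly the fraction \<open>2\<^sup>-\<^sup>k\<close> of its subsquares, and since \<open>M\<close> grows like
  \<open>2\<close> to the power \<open>k\<^sup>3\<close>, while the total loss is \<open>2\<close> to the power \<open>O(k\<^sup>2)\<close>, the trivial bound
  \<open>O(M\<^sup>2 d\<^sup>2)\<close> for the number of subsquares meeting a set of diameter \<open>d\<close> gives a mass
  distribution estimate for every exponent \<open>s < 2\<close>.\<close>

section \<open>The nested squares\<close>

definition grid :: "nat \<Rightarrow> int" where "grid k = 2 ^ (k ^ 3)"

text \<open>The exponent is \<open>(k + 1) ^ 3 - k ^ 3\<close>, so a square of side
  \<open>1 / grid k\<close> splits into \<open>ratio k\<close> by \<open>ratio k\<close> squares of
  the next level.\<close>

definition ratio :: "nat \<Rightarrow> int" where "ratio k = 2 ^ (3 * k\<^sup>2 + 3 * k + 1)"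

text \<open>Up to a scalar, every linear functional on the plane is \<open>skew h\<close> with \<open>\<bar>snd h\<bar> \<le> 1\<close>: the flag
  records which coordinate has the larger coefficient, normalised to \<open>1\<close>. This makes the
  selection exactly equidistributed, because for a fixed value of the other coordinate the
  rounded functional runs through consecutive integers.\<close>

definition skew :: "bool \<times> real \<Rightarrow> real \<times> real \<Rightarrow> real" where
  "skew h x = (if fst h then snd x + snd h * fst x else fst x + snd h * snd x)"

definition selected :: "bool \<times> real \<Rightarrow> int \<Rightarrow> int \<times> int \<Rightarrow> bool" where
  "selected h p t \<longleftrightarrow>
     p dvd (if fst h then snd t + \<lfloor>snd h * real_of_int (fst t)\<rfloor> else fst t + \<lfloor>snd h * real_of_int (snd t)\<rfloor>)"

text \<open>Indices are absolute positions on the grid, so \<open>parent k\<close> leads from level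
  \<open>Suc k\<close> back to level \<open>k\<close>. The passage between these two levels is
  governed by \<open>g k\<close> with modulus \<open>2 ^ k\<close>.\<close>

definition parent :: "nat \<Rightarrow> int \<times> int \<Rightarrow> int \<times> int" where
  "parent k t = (fst t div ratio k, snd t div ratio k)"

primrec cells :: "(nat \<Rightarrow> bool \<times> real) \<Rightarrow> nat \<Rightarrow> (int \<times> int) set" where
  "cells g 0 = {(0, 0)}"
| "cells g (Suc k) = {t. parent k t \<in> cells g k \<and> selected (g k) (2 ^ k) t}"

definition square :: "nat \<Rightarrow> int \<times> int \<Rightarrow> (real \<times> real) set" where
  "square k t =
     {of_int (fst t) / of_int (grid k)..(of_int (fst t) + 1) / of_int (grid k)} \<times>
     {of_int (snd t) / of_int (grid k)..(of_int (snd t) + 1) / of_int (grid k)}"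

definition level :: "(nat \<Rightarrow> bool \<times> real) \<Rightarrow> nat \<Rightarrow> (real \<times> real) set" where
  "level g k = (\<Union>t\<in>cells g k. square k t)"

definition limit_set :: "(nat \<Rightarrow> bool \<times> real) \<Rightarrow> (real \<times> real) set" where
  "limit_set g = (\<Inter>k. level g k)"

text \<open>The proportion of cells counted here stands in for the mass of \<open>U\<close> under
  the uniform measure on the limit set, so that no measure has to be constructed.\<close>

definition hitting :: "(nat \<Rightarrow> bool \<times> real) \<Rightarrow> nat \<Rightarrow> (real \<times> real) set \<Rightarrow> (int \<times> int) set" where
  "hitting g k U = {t \<in> cells g k. square k t \<inter> U \<noteq> {}}"

lemma grid_pos: "grid k > 0" and ratio_pos: "ratio k > 0"
  by (auto simp: grid_def ratio_def)

lemma grid_Suc: "grid (Suc k) = grid k * ratio k"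
  unfolding grid_def ratio_def power_add[symmetric]
  by (simp add: power3_eq_cube power2_eq_square algebra_simps)

lemma ratio_eq: "ratio k = 2 ^ k * 2 ^ (3 * k\<^sup>2 + 2 * k + 1)"
  unfolding ratio_def power_add[symmetric] by (simp add: algebra_simps)

section \<open>Counting the selected subsquares\<close>

lemma card_shifted_multiples:
  fixes p n u c :: int
  assumes "p > 0"
  shows "card {i \<in> {u..<u + p * n}. p dvd i + c} = nat n"
proof -
  \<comment> \<open>\<open>w\<close> is the ceiling of \<open>(u + c) / p\<close>, so the multiples
    of \<open>p\<close> in the shifted interval are the \<open>p * z\<close> with \<open>z\<close>
    from \<open>w\<close> to \<open>w + n - 1\<close>.\<close>
  define w where "w = - ((- (u + c)) div p)"
  have ge: "u + c \<le> p * z \<longleftrightarrow> w \<le> z" for z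
  proof
    assume "u + c \<le> p * z"
    then have "(- z * p) div p \<le> (- (u + c)) div p"
      using assms by (intro zdiv_mono1) (auto simp: algebra_simps)
    moreover have "(- z * p) div p = - z" using assms by (intro nonzero_mult_div_cancel_right) auto
    ultimately show "w \<le> z" unfolding w_def by linarith
  next
    assume "w \<le> z"
    then have "p * w \<le> p * z" using assms by simp
    moreover have "u + c \<le> p * w"
      using mult_div_mod_eq[of p "- (u + c)"] pos_mod_sign[OF assms, of "- (u + c)"]
      unfolding w_def mult_minus_right by linarith
    ultimately show "u + c \<le> p * z" by linarith
  qed
  have lt: "p * z < u + c + p * n \<longleftrightarrow> z < w + n" for z
    using ge[of "z - n"] by (simp add: algebra_simps) linarith
  have "{i \<in> {u..<u + p * n}. p dvd i + c} = (\<lambda>z. p * z - c) ` {w..<w + n}"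
  proof (intro set_eqI iffI)
    fix i assume i: "i \<in> {i \<in> {u..<u + p * n}. p dvd i + c}"
    then obtain z where z: "i + c = p * z" by (auto elim: dvdE)
    with i ge[of z] lt[of z] have "z \<in> {w..<w + n}" by auto
    then show "i \<in> (\<lambda>z. p * z - c) ` {w..<w + n}" using z by (intro image_eqI[of _ _ z]) auto
  next
    fix i assume "i \<in> (\<lambda>z. p * z - c) ` {w..<w + n}"
    then obtain z where z: "i = p * z - c" "z \<in> {w..<w + n}" by (elim imageE)
    then have "w \<le> z" "z < w + n" by simp_all
    have "i + c = p * z" using z by simp
    then have "p dvd i + c" by simp
    moreover have "u \<le> i" "i < u + p * n"
      using z(1) \<open>w \<le> z\<close> \<open>z < w + n\<close> ge[of z] lt[of z] by linarith+
    ultimately show "i \<in> {i \<in> {u..<u + p * n}. p dvd i + c}" by simp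
  qed
  moreover have "inj_on (\<lambda>z. p * z - c) {w..<w + n}"
    using assms by (auto intro!: inj_onI)
  ultimately show ?thesis by (simp add: card_image)
qed

text \<open>Once the coordinate multiplied by \<open>snd h\<close> is fixed, the floor term is a
  constant shift, so exactly one in \<open>p\<close> values of the other coordinate is selected. The
  count is exact for every slope and every block \<open>b\<close>.\<close>

lemma card_block:
  fixes p n :: int
  assumes "p > 0" "n > 0"
  shows "card {t. (fst t div (p * n), snd t div (p * n)) = b \<and> selected h p t} = nat (p * n) * nat n"
proof -
  define R where "R = p * n"
  have R: "R > 0" using assms by (simp add: R_def)
  obtain u v where b: "b = (u, v)" by (cases b)
  have div: "i div R = u \<longleftrightarrow> i \<in> {u * R..<u * R + R}" for i u :: int
  proof
    assume "i div R = u"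
    then show "i \<in> {u * R..<u * R + R}"
      using div_mult_mod_eq[of i R] pos_mod_bound[OF R, of i] pos_mod_sign[OF R, of i] by auto
  next
    assume "i \<in> {u * R..<u * R + R}"
    then show "i div R = u" by (intro int_div_pos_eq[of i R u "i - u * R"]) (auto simp: algebra_simps)
  qed
  have card: "card (SIGMA j:{v * R..<v * R + R}. {i \<in> {u * R..<u * R + R}. p dvd i + c j}) = nat R * nat n"
    for u v :: int and c :: "int \<Rightarrow> int"
  proof -
    have "finite {i \<in> {u * R..<u * R + R}. p dvd i + c j}" for j
      by (rule finite_subset[of _ "{u * R..<u * R + R}"]) auto
    then show ?thesis
      using card_shifted_multiples[OF assms(1), of "u * R" n]
      by (subst card_SigmaI) (auto simp: R_def simp del: atLeastLessThan_iff)
  qed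
  show ?thesis
  proof (cases "fst h")
    case True
    have "{t. (fst t div R, snd t div R) = b \<and> selected h p t} =
      (SIGMA i:{u * R..<u * R + R}. {j \<in> {v * R..<v * R + R}. p dvd j + \<lfloor>snd h * i\<rfloor>})"
      using True by (auto simp: selected_def b div)
    then show ?thesis using card[of u v "\<lambda>i. \<lfloor>snd h * i\<rfloor>"] card[of v u "\<lambda>i. \<lfloor>snd h * i\<rfloor>"] by (simp add: R_def)
  next
    case False
    \<comment> \<open>The swap puts the fixed coordinate first, which gives the dependent pairs the
      shape counted in \<open>card\<close>.\<close>
    have "{t. (fst t div R, snd t div R) = b \<and> selected h p t} = prod.swap `
      (SIGMA j:{v * R..<v * R + R}. {i \<in> {u * R..<u * R + R}. p dvd i + \<lfloor>snd h * j\<rfloor>})"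
      using False by (force simp: selected_def b div image_iff)
    then show ?thesis using card[of v u "\<lambda>i. \<lfloor>snd h * i\<rfloor>"] by (simp add: R_def card_image)
  qed
qed

text \<open>The first factor counts the values of the unconstrained coordinate; the second is
  \<open>ratio k / 2 ^ k\<close>, the number of selected values of the other one.\<close>

definition child_count :: "nat \<Rightarrow> nat" where
  "child_count k = nat (ratio k) * 2 ^ (3 * k\<^sup>2 + 2 * k + 1)"

lemma child_count_pos: "child_count k > 0"
  by (simp add: child_count_def ratio_pos)

lemma child_count_ratio: "real (child_count k) * 2 ^ k = (real_of_int (ratio k))\<^sup>2"
proof -
  have "real (child_count k) * 2 ^ k = real_of_int (ratio k) * (2 ^ k * 2 ^ (3 * k\<^sup>2 + 2 * k + 1))"
    using ratio_pos[of k] by (simp add: child_count_def)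
  also have "\<dots> = (real_of_int (ratio k))\<^sup>2"
    by (simp add: ratio_eq power2_eq_square)
  finally show ?thesis .
qed

lemma card_block_ratio: "card {t. parent k t = b \<and> selected h (2 ^ k) t} = child_count k"
proof -
  have "nat (2 ^ (3 * k\<^sup>2 + 2 * k + 1)) = 2 ^ (3 * k\<^sup>2 + 2 * k + 1)"
    by (subst nat_power_eq) auto
  then show ?thesis
    using card_block[of "2 ^ k" "2 ^ (3 * k\<^sup>2 + 2 * k + 1)" b h]
    unfolding parent_def child_count_def ratio_eq by simp
qed

lemma card_children:
  assumes "finite B" "B \<subseteq> cells g k"
  shows "card {t \<in> cells g (Suc k). parent k t \<in> B} = card B * child_count k"
proof -
  have "{t \<in> cells g (Suc k). parent k t \<in> B} = (\<Union>b\<in>B. {t. parent k t = b \<and> selected (g k) (2 ^ k) t})"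
    using assms by auto
  also have "card \<dots> = (\<Sum>b\<in>B. card {t. parent k t = b \<and> selected (g k) (2 ^ k) t})"
    \<comment> \<open>Finiteness of the sets of children is read off from their positive
      cardinality.\<close>
    using assms(1) child_count_pos[of k]
    by (intro card_UN_disjoint) (auto intro!: card_ge_0_finite simp del: selected_def simp: card_block_ratio)
  finally show ?thesis by (simp add: card_block_ratio)
qed

lemma finite_cells: "finite (cells g k)"
  and card_cells_pos: "card (cells g k) > 0"
proof -
  have "finite (cells g k) \<and> card (cells g k) > 0"
  proof (induction k)
    case (Suc k)
    have "{t \<in> cells g (Suc k). parent k t \<in> cells g k} = cells g (Suc k)" by auto
    with card_children[of "cells g k" g k] Suc child_count_pos[of k]
    have "card (cells g (Suc k)) > 0" by (simp del: cells.simps)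
    then show ?case using card_ge_0_finite by blast
  qed simp
  then show "finite (cells g k)" "card (cells g k) > 0" by auto
qed

lemma card_cells_Suc: "card (cells g (Suc k)) = card (cells g k) * child_count k"
proof -
  have "{t \<in> cells g (Suc k). parent k t \<in> cells g k} = cells g (Suc k)" by auto
  with card_children[of "cells g k" g k] finite_cells show ?thesis by (simp del: cells.simps)
qed

text \<open>Step \<open>j\<close> costs a factor \<open>2 ^ j\<close>. Over \<open>j < k\<close> the
  exponents add up to \<open>k * (k - 1) / 2\<close>, for which \<open>k ^ 2\<close> is a convenient
  upper bound.\<close>

lemma card_cells: "(real_of_int (grid k))\<^sup>2 \<le> real (card (cells g k)) * 2 ^ k\<^sup>2"
proof (induction k)
  case (Suc k)
  have "(real_of_int (grid (Suc k)))\<^sup>2 = (real_of_int (grid k))\<^sup>2 * (real (child_count k) * 2 ^ k)"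
    by (simp add: grid_Suc child_count_ratio power_mult_distrib)
  also have "\<dots> \<le> (real (card (cells g k)) * 2 ^ k\<^sup>2) * (real (child_count k) * 2 ^ k)"
    by (intro mult_right_mono Suc) auto
  also have "\<dots> = real (card (cells g (Suc k))) * 2 ^ (k\<^sup>2 + k)"
    by (simp add: card_cells_Suc power_add del: cells.simps)
  also have "\<dots> \<le> real (card (cells g (Suc k))) * 2 ^ (Suc k)\<^sup>2"
    by (intro mult_left_mono power_increasing) (auto simp: power2_eq_square)
  finally show ?case .
qed (simp add: grid_def)

section \<open>Nested squares and hit proportions\<close>

lemma square_Suc_subset: "square (Suc k) t \<subseteq> square k (parent k t)"
proof -
  have *: "real_of_int (i div R) / M \<le> i / (M * R)" "(i + 1) / (M * R) \<le> (real_of_int (i div R) + 1) / M"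
    if "R > 0" "M > 0" for i R M :: int
  proof -
    have "i div R * R \<le> i" "i + 1 \<le> (i div R + 1) * R"
      using div_mult_mod_eq[of i R] pos_mod_bound[OF that(1), of i] pos_mod_sign[OF that(1), of i]
      unfolding distrib_right mult_1 by linarith+
    then have "real_of_int (i div R) * R \<le> i" "real_of_int i + 1 \<le> (real_of_int (i div R) + 1) * R"
      by (metis of_int_le_iff of_int_mult of_int_add of_int_1)+
    then have "(real_of_int (i div R) * R) / (M * R) \<le> i / (M * R)"
        "(real_of_int i + 1) / (M * R) \<le> ((real_of_int (i div R) + 1) * R) / (M * R)"
      using that by (intro divide_right_mono; simp)+
    then show "real_of_int (i div R) / M \<le> i / (M * R)" "(i + 1) / (M * R) \<le> (real_of_int (i div R) + 1) / M"
      using that by simp_all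
  qed
  note a = *[OF ratio_pos[of k] grid_pos[of k]]
  show ?thesis
    using a[of "fst t"] a[of "snd t"]
    unfolding square_def parent_def grid_Suc by (auto intro: order_trans)
qed

lemma level_Suc_subset: "level g (Suc k) \<subseteq> level g k"
  using square_Suc_subset unfolding level_def by fastforce

lemma level_antimono: "k \<le> l \<Longrightarrow> level g l \<subseteq> level g k"
  by (rule lift_Suc_antimono_le[of "level g"]) (auto intro: level_Suc_subset[THEN subsetD])

lemma compact_level: "compact (level g k)"
  unfolding level_def square_def by (intro compact_UN finite_cells compact_Times compact_Icc)

lemma square_nonempty: "square k t \<noteq> {}"
  using grid_pos[of k] by (auto simp: square_def divide_right_mono)

lemma limit_set_subset: "limit_set g \<subseteq> {0..1} \<times> {0..1}"
proof -
  have "level g 0 = {0..1} \<times> {0..1}" by (simp add: level_def square_def grid_def)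
  then show ?thesis unfolding limit_set_def by auto
qed

text \<open>A square meeting \<open>U\<close> lies in a parent meeting \<open>U\<close>, and all
  cells have equally many children, so the hit proportion cannot grow with the level.
  Cross-multiplication keeps the inequality in the naturals.\<close>

lemma hitting_Suc:
  "card (hitting g (Suc k) U) * card (cells g k) \<le> card (hitting g k U) * card (cells g (Suc k))"
proof -
  have "hitting g (Suc k) U \<subseteq> {t \<in> cells g (Suc k). parent k t \<in> hitting g k U}"
    using square_Suc_subset unfolding hitting_def by fastforce
  then have "card (hitting g (Suc k) U) \<le> card {t \<in> cells g (Suc k). parent k t \<in> hitting g k U}"
    by (intro card_mono) (auto simp: finite_cells simp del: cells.simps)
  also have "\<dots> = card (hitting g k U) * child_count k"
    by (intro card_children) (auto simp: hitting_def finite_cells)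
  finally show ?thesis by (simp add: card_cells_Suc del: cells.simps)
qed

lemma hitting_mono:
  assumes "l \<le> k"
  shows "real (card (hitting g k U)) / card (cells g k) \<le> real (card (hitting g l U)) / card (cells g l)"
  using assms
proof (induction rule: dec_induct)
  case (step k)
  have "real (card (hitting g (Suc k) U)) / card (cells g (Suc k)) \<le> real (card (hitting g k U)) / card (cells g k)"
    using hitting_Suc[of g k U] card_cells_pos[of g k] card_cells_pos[of g "Suc k"]
    by (simp add: field_simps flip: of_nat_mult del: cells.simps)
  with step show ?case by linarith
qed simp

section \<open>Covering estimates and the dimension\<close>

text \<open>Two hit indices differ by at most \<open>M * d + 1\<close> in each coordinate, hence by
  at most the integer \<open>L\<close>. This leaves a box of \<open>(2 * L + 1) ^ 2\<close> indices,
  and \<open>1 <= M * d\<close> bounds \<open>2 * L + 1\<close> by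
  \<open>5 * (M * d)\<close>.\<close>

lemma card_hitting_le:
  fixes d :: real
  assumes diam: "\<And>x y. x \<in> U \<Longrightarrow> y \<in> U \<Longrightarrow> dist x y \<le> d" and d: "1 \<le> grid k * d"
  shows "real (card (hitting g k U)) \<le> 25 * (real_of_int (grid k))\<^sup>2 * d\<^sup>2"
proof (cases "hitting g k U = {}")
  case False
  define M where "M = real_of_int (grid k)"
  have M: "M > 0" using grid_pos by (simp add: M_def)
  define L where "L = \<lfloor>M * d\<rfloor> + 1"
  obtain s where s: "s \<in> hitting g k U" using False by auto
  have "\<bar>fst t - fst s\<bar> \<le> L \<and> \<bar>snd t - snd s\<bar> \<le> L" if t: "t \<in> hitting g k U" for t
  proof -
    obtain x y where x: "x \<in> square k s" "x \<in> U" and y: "y \<in> square k t" "y \<in> U"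
      using s t unfolding hitting_def by auto
    have "\<bar>fst x - fst y\<bar> \<le> d" "\<bar>snd x - snd y\<bar> \<le> d"
      using diam[OF x(2) y(2)] dist_fst_le[of x y] dist_snd_le[of x y] by (auto simp: dist_real_def)
    then have "\<bar>M * fst x - M * fst y\<bar> \<le> M * d" "\<bar>M * snd x - M * snd y\<bar> \<le> M * d"
      using M by (auto simp flip: right_diff_distrib simp: abs_mult)
    moreover have "real_of_int (fst s) \<le> M * fst x" "M * fst x \<le> real_of_int (fst s) + 1"
      "real_of_int (snd s) \<le> M * snd x" "M * snd x \<le> real_of_int (snd s) + 1"
      "real_of_int (fst t) \<le> M * fst y" "M * fst y \<le> real_of_int (fst t) + 1"
      "real_of_int (snd t) \<le> M * snd y" "M * snd y \<le> real_of_int (snd t) + 1"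
      using x(1) y(1) M unfolding square_def M_def[symmetric] by (auto simp: field_simps)
    ultimately have "\<bar>real_of_int (fst t) - real_of_int (fst s)\<bar> \<le> M * d + 1"
      "\<bar>real_of_int (snd t) - real_of_int (snd s)\<bar> \<le> M * d + 1" by linarith+
    then show ?thesis unfolding L_def by linarith
  qed
  then have "hitting g k U \<subseteq> {fst s - L..fst s + L} \<times> {snd s - L..snd s + L}" by force
  then have "card (hitting g k U) \<le> nat (2 * L + 1) * nat (2 * L + 1)"
    using card_mono[of "{fst s - L..fst s + L} \<times> {snd s - L..snd s + L}" "hitting g k U"]
    by (simp add: card_cartesian_product algebra_simps)
  moreover have L: "0 \<le> 2 * L + 1" "real_of_int (2 * L + 1) \<le> 5 * (M * d)"
  proof -
    have "1 \<le> \<lfloor>M * d\<rfloor>" using d unfolding M_def[symmetric] by simp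
    then show "0 \<le> 2 * L + 1" by (simp add: L_def)
    have "real_of_int (2 * L + 1) = 2 * of_int \<lfloor>M * d\<rfloor> + 3" by (simp add: L_def)
    also have "\<dots> \<le> 2 * (M * d) + 3 * (M * d)"
      using d unfolding M_def[symmetric] by (intro add_mono) auto
    finally show "real_of_int (2 * L + 1) \<le> 5 * (M * d)" by simp
  qed
  ultimately have "real (card (hitting g k U)) \<le> real_of_int (2 * L + 1) * real_of_int (2 * L + 1)"
    by (metis of_nat_le_iff of_nat_mult of_nat_nat)
  also have "\<dots> \<le> (5 * (M * d)) * (5 * (M * d))"
    using L by (intro mult_mono) auto
  finally show ?thesis by (simp add: M_def power2_eq_square algebra_simps)
qed simp

lemma ex_grid_bracket:
  assumes "0 < d" "d \<le> (1::real)"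
  shows "\<exists>l. d \<le> 1 / grid l \<and> 1 / grid (Suc l) < d"
proof -
  have "\<exists>n. 1 / grid n < d"
  proof -
    obtain n where n: "1 / d < 2 ^ n" using real_arch_pow[of 2 "1 / d"] by auto
    have "(2::real) ^ n \<le> 2 ^ n ^ 3" by (intro power_increasing) (auto simp: power3_eq_cube)
    with n have "1 / d < 2 ^ n ^ 3" by linarith
    then show ?thesis using assms by (intro exI[of _ n]) (auto simp: grid_def field_simps)
  qed
  then obtain n where n: "1 / grid n < d" "\<And>m. m < n \<Longrightarrow> \<not> 1 / grid m < d"
    using exists_least_iff[of "\<lambda>n. 1 / grid n < d"] by auto
  \<comment> \<open>Index 0 is excluded because \<open>grid 0 = 1\<close> and \<open>d <= 1\<close>,
    so the least \<open>n\<close> has a predecessor.\<close>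
  have "n \<noteq> 0" using n(1) assms by (intro notI) (auto simp: grid_def)
  then obtain l where "n = Suc l" by (cases n) auto
  with n(1) n(2)[of l] show ?thesis by (intro exI[of _ l]) auto
qed

text \<open>Bounds the exponent of 2 in the mass estimate uniformly in the level: beyond
  \<open>l = 1 / \<eta>\<close> the cubic term wins, and up to there the square is at most
  \<open>1 / \<eta> ^ 2\<close>.\<close>

lemma square_minus_cube_le:
  fixes l \<eta> :: real
  assumes "\<eta> > 0" "l \<ge> 0"
  shows "l\<^sup>2 - \<eta> * l ^ 3 \<le> 1 / \<eta>\<^sup>2"
proof (cases "\<eta> * l \<le> 1")
  case True
  have "(\<eta> * l)\<^sup>2 \<le> 1" using True assms by (simp add: power_le_one)
  then have "l\<^sup>2 \<le> 1 / \<eta>\<^sup>2" using assms by (simp add: field_simps power_mult_distrib)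
  moreover have "\<eta> * l ^ 3 \<ge> 0" using assms by simp
  ultimately show ?thesis by linarith
next
  case False
  then have "l\<^sup>2 * 1 \<le> l\<^sup>2 * (\<eta> * l)" by (intro mult_left_mono) auto
  moreover have "l\<^sup>2 * (\<eta> * l) = \<eta> * l ^ 3" by (simp add: power3_eq_cube power2_eq_square)
  moreover have "0 \<le> 1 / \<eta>\<^sup>2" by simp
  ultimately show ?thesis by linarith
qed

text \<open>A Frostman type estimate. At the first level \<open>m\<close> finer than
  \<open>d\<close>, trivial counting gives \<open>25 * 2 ^ (m ^ 2) * d ^ 2\<close>. A factor
  \<open>d powr s\<close> is set aside, and the remaining \<open>d powr \<eta>\<close>, at most
  \<open>2 powr (- \<eta> * l ^ 3)\<close>, absorbs the selection loss. Monotonicity carries the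
  bound to later levels.\<close>

lemma hitting_proportion_le:
  fixes s d :: real
  assumes s: "s < 2" and d: "0 < d" "d \<le> 1"
    and diam: "\<And>x y. x \<in> U \<Longrightarrow> y \<in> U \<Longrightarrow> dist x y \<le> d"
  shows "\<exists>l. \<forall>k\<ge>l. real (card (hitting g k U)) / card (cells g k)
           \<le> 100 * 2 powr (8 / (2 - s)\<^sup>2) * d powr s"
proof -
  define \<eta> where "\<eta> = 2 - s"
  have \<eta>: "\<eta> > 0" using s by (simp add: \<eta>_def)
  obtain l where l: "d \<le> 1 / grid l" "1 / grid (Suc l) < d" using ex_grid_bracket[OF d] by auto
  define m where "m = Suc l"
  have "real (card (hitting g k U)) / card (cells g k) \<le> 100 * 2 powr (8 / (2 - s)\<^sup>2) * d powr s"
    if "k \<ge> m" for k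
  proof -
    have "1 \<le> grid m * d" using l(2) grid_pos[of m] by (simp add: m_def field_simps)
    then have "real (card (hitting g m U)) \<le> 25 * (real_of_int (grid m))\<^sup>2 * d\<^sup>2"
      by (intro card_hitting_le diam)
    also have "\<dots> \<le> 25 * (real (card (cells g m)) * 2 ^ m\<^sup>2) * d\<^sup>2"
      by (intro mult_left_mono mult_right_mono card_cells) auto
    finally have "real (card (hitting g m U)) / card (cells g m) \<le> 25 * 2 ^ m\<^sup>2 * d\<^sup>2"
      using card_cells_pos[of g m] by (simp add: field_simps)
    also have "d\<^sup>2 = d powr s * d powr \<eta>"
      using d by (simp add: \<eta>_def flip: powr_add)
    also have "d powr \<eta> \<le> (1 / grid l) powr \<eta>"
      using d l(1) \<eta> by (intro powr_mono2) auto
    also have "(1 / grid l) powr \<eta> = 2 powr (- \<eta> * l ^ 3)"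
      by (simp add: grid_def powr_divide powr_minus powr_powr flip: powr_realpow) (simp add: field_simps)
    also have "25 * 2 ^ m\<^sup>2 * (d powr s * 2 powr (- \<eta> * l ^ 3)) =
        25 * d powr s * 2 powr (real m ^ 2 - \<eta> * l ^ 3)"
      by (simp add: powr_diff powr_minus field_simps flip: powr_realpow)
    \<comment> \<open>The exponent comes from \<open>(l + 1) ^ 2 <= 2 * l ^ 2 + 2\<close> and twice
      the square-cube bound taken at \<open>\<eta> / 2\<close>; the surplus 2 turns 25 into
      100.\<close>
    also have "\<dots> \<le> 25 * d powr s * 2 powr (8 / \<eta>\<^sup>2 + 2)"
    proof (intro mult_left_mono powr_mono)
      have "real m ^ 2 \<le> 2 * real l ^ 2 + 2"
        using zero_le_power2[of "real l - 1"] by (simp add: m_def power2_eq_square algebra_simps)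
      moreover have "real l ^ 2 - (\<eta> / 2) * real l ^ 3 \<le> 1 / (\<eta> / 2)\<^sup>2"
        using \<eta> by (intro square_minus_cube_le) auto
      ultimately show "real m ^ 2 - \<eta> * l ^ 3 \<le> 8 / \<eta>\<^sup>2 + 2"
        by (simp add: field_simps power_divide)
    qed auto
    also have "\<dots> = 100 * 2 powr (8 / (2 - s)\<^sup>2) * d powr s"
      by (simp add: powr_add \<eta>_def)
    finally show ?thesis
      using hitting_mono[OF that, of g U] d by (simp add: mult_left_mono)
  qed
  then show ?thesis by blast
qed

section \<open>Covers of the limit set\<close>

lemma finite_subcover_level:
  fixes U :: "nat \<Rightarrow> (real \<times> real) set"
  assumes "\<And>n. open (U n)" "limit_set g \<subseteq> (\<Union>n. U n)"
  shows "\<exists>I l. finite I \<and> (\<forall>k\<ge>l. level g k \<subseteq> (\<Union>n\<in>I. U n))"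
proof -
  \<comment> \<open>A point outside the limit set misses some level, so adding the complements
    yields an open cover of the compact set \<open>level g 0\<close>. From the largest index of a
    finite subcover on, the added parts contain no point of the level.\<close>
  define V where "V n = U n \<union> - level g n" for n :: nat
  have "level g 0 \<subseteq> (\<Union>n. V n)"
  proof
    fix x assume "x \<in> level g 0"
    show "x \<in> (\<Union>n. V n)"
      using assms(2) by (cases "x \<in> limit_set g") (auto simp: V_def limit_set_def)
  qed
  moreover have "open (V n)" for n
    unfolding V_def by (intro open_Un assms open_Compl compact_imp_closed compact_level)
  ultimately obtain I where I: "finite I" "level g 0 \<subseteq> (\<Union>n\<in>I. V n)"
    using compactE_image[OF compact_level[of g 0], of UNIV V] by auto
  obtain l where l: "\<And>n. n \<in> I \<Longrightarrow> n \<le> l" using finite_nat_set_iff_bounded_le[of I] I(1) by auto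
  have "level g k \<subseteq> (\<Union>n\<in>I. U n)" if "k \<ge> l" for k
  proof
    fix x assume x: "x \<in> level g k"
    then have "x \<in> level g 0" using level_antimono[of 0 k] by auto
    then obtain n where n: "n \<in> I" "x \<in> V n" using I by auto
    then have "x \<in> level g n" using x level_antimono[of n k] l[of n] that by auto
    with n show "x \<in> (\<Union>n\<in>I. U n)" by (auto simp: V_def)
  qed
  then show ?thesis using I(1) by blast
qed

text \<open>At a late common level every cell meets some \<open>U n\<close> of a finite subcover, so
  the hit proportions add up to at least 1, while each is at most a constant times
  \<open>d n powr s\<close>.\<close>

lemma open_cover_sum_ge:
  fixes s :: real and U :: "nat \<Rightarrow> (real \<times> real) set"
  assumes s: "s < 2" and U: "\<And>n. open (U n)" "limit_set g \<subseteq> (\<Union>n. U n)"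
    and d: "\<And>n. 0 < d n" "\<And>n. d n \<le> 1"
    and diam: "\<And>n x y. x \<in> U n \<Longrightarrow> y \<in> U n \<Longrightarrow> dist x y \<le> d n"
  shows "\<exists>I. finite I \<and> 1 \<le> 100 * 2 powr (8 / (2 - s)\<^sup>2) * (\<Sum>n\<in>I. d n powr s)"
proof -
  define c where "c = 100 * 2 powr (8 / (2 - s)\<^sup>2)"
  obtain I l where I: "finite I" "\<And>k. k \<ge> l \<Longrightarrow> level g k \<subseteq> (\<Union>n\<in>I. U n)"
    using finite_subcover_level[OF U] by blast
  have "\<exists>m. \<forall>k\<ge>m. real (card (hitting g k (U n))) / card (cells g k) \<le> c * d n powr s" for n
    unfolding c_def using s d diam by (intro hitting_proportion_le) auto
  then obtain m where m: "\<And>n k. k \<ge> m n \<Longrightarrow>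
      real (card (hitting g k (U n))) / card (cells g k) \<le> c * d n powr s" by metis
  \<comment> \<open>The sum serves as a common upper bound for the finitely many thresholds.\<close>
  define k where "k = l + (\<Sum>n\<in>I. m n)"
  have k: "k \<ge> l" "\<And>n. n \<in> I \<Longrightarrow> k \<ge> m n"
    using I(1) by (auto simp: k_def intro: trans_le_add2 member_le_sum)
  have "cells g k \<subseteq> (\<Union>n\<in>I. hitting g k (U n))"
  proof
    fix t assume t: "t \<in> cells g k"
    obtain x where x: "x \<in> square k t" using square_nonempty[of k t] by blast
    then have "x \<in> level g k" using t by (auto simp: level_def)
    with I(2)[OF k(1)] obtain n where "n \<in> I" "x \<in> U n" by blast
    with x t show "t \<in> (\<Union>n\<in>I. hitting g k (U n))" unfolding hitting_def by blast
  qed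
  then have "card (cells g k) \<le> card (\<Union>n\<in>I. hitting g k (U n))"
    using I(1) finite_cells[of g k] by (intro card_mono) (auto simp: hitting_def)
  also have "\<dots> \<le> (\<Sum>n\<in>I. card (hitting g k (U n)))" by (rule card_UN_le[OF I(1)])
  finally have "real (card (cells g k)) \<le> (\<Sum>n\<in>I. real (card (hitting g k (U n))))"
    by (simp flip: of_nat_sum)
  then have "1 \<le> (\<Sum>n\<in>I. real (card (hitting g k (U n)))) / card (cells g k)"
    using card_cells_pos[of g k] by simp
  also have "\<dots> = (\<Sum>n\<in>I. real (card (hitting g k (U n))) / card (cells g k))"
    by (rule sum_divide_distrib)
  also have "\<dots> \<le> (\<Sum>n\<in>I. c * d n powr s)" by (intro sum_mono m k)
  finally show ?thesis using I(1) by (auto simp: c_def sum_distrib_left)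
qed

text \<open>Lets a covering set of diameter \<open>D\<close> be thickened to an open one at
  arbitrarily small cost. The value \<open>D = 0\<close> occurs, and there continuity of the power
  rests on \<open>s > 0\<close>.\<close>

lemma ex_larger_powr_close:
  fixes D s e :: real
  assumes "0 \<le> D" "D < 1" "s > 0" "e > 0"
  shows "\<exists>d>D. d \<le> 1 \<and> d powr s \<le> D powr s + e"
proof -
  have "((\<lambda>d. d powr s) \<longlongrightarrow> D powr s) (at_right D)"
    using assms by (intro tendsto_powr' tendsto_const tendsto_ident_at)
      (auto simp: eventually_at_filter intro!: always_eventually)
  then have "\<forall>\<^sub>F d in at_right D. d powr s < D powr s + e"
    using assms by (intro order_tendstoD) auto
  moreover have "\<forall>\<^sub>F d in at_right D. D < d \<and> d < 1"
    using assms eventually_at_right_less[of D] by (auto simp: eventually_at_right intro!: exI[of _ 1])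
  ultimately have "\<forall>\<^sub>F d in at_right D. D < d \<and> d < 1 \<and> d powr s < D powr s + e"
    by eventually_elim auto
  then obtain d where "D < d" "d < 1" "d powr s < D powr s + e"
    using eventually_happens'[of "at_right D"] by (auto simp: trivial_limit_at_right_real)
  then show ?thesis by (intro exI[of _ d]) auto
qed

lemma cover_sum_ge:
  fixes s :: real
  assumes s: "0 < s" "s < 2" and cover: "limit_set g \<subseteq> (\<Union>n. C n)"
    and C: "\<And>n. bounded (C n)" "\<And>n. diameter (C n) \<le> 1 / 2"
  shows "ennreal (1 / (200 * 2 powr (8 / (2 - s)\<^sup>2))) \<le> (\<Sum>n. ennreal (diameter (C n) powr s))"
proof -
  define c where "c = 100 * 2 powr (8 / (2 - s)\<^sup>2)"
  have c: "c > 0" by (simp add: c_def)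
  \<comment> \<open>The excesses sum to at most \<open>1 / (2 * c)\<close>, half of the lower bound
    \<open>1 / c\<close> for open covers; hence 200 in place of 100 in the final constant.\<close>
  have "\<exists>d. d > diameter (C n) \<and> d \<le> 1 \<and> d powr s \<le> diameter (C n) powr s + (1 / 2) ^ Suc n / (2 * c)" for n
    using ex_larger_powr_close[of "diameter (C n)" s "(1 / 2) ^ Suc n / (2 * c)"] C(2)[of n] s c
      diameter_ge_0[OF C(1)[of n]] by auto
  then obtain d where d: "\<And>n. diameter (C n) < d n" "\<And>n. d n \<le> 1"
      "\<And>n. d n powr s \<le> diameter (C n) powr s + (1 / 2) ^ Suc n / (2 * c)" by metis
  define U where "U n = (\<Union>x\<in>C n. ball x ((d n - diameter (C n)) / 2))" for n
  have "\<exists>I. finite I \<and> 1 \<le> 100 * 2 powr (8 / (2 - s)\<^sup>2) * (\<Sum>n\<in>I. d n powr s)"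
  proof (rule open_cover_sum_ge)
    show "open (U n)" for n by (auto simp: U_def)
    have "C n \<subseteq> U n" for n using d(1)[of n] by (force simp: U_def)
    then show "limit_set g \<subseteq> (\<Union>n. U n)" using cover by fastforce
    show "0 < d n" for n using d(1)[of n] diameter_ge_0[OF C(1)[of n]] by linarith
    show "dist x y \<le> d n" if "x \<in> U n" "y \<in> U n" for n x y
    proof -
      obtain x' y' where *: "x' \<in> C n" "y' \<in> C n" "dist x' x < (d n - diameter (C n)) / 2"
          "dist y' y < (d n - diameter (C n)) / 2"
        using \<open>x \<in> U n\<close> \<open>y \<in> U n\<close> by (auto simp: U_def)
      have "dist x' y' \<le> diameter (C n)" using diameter_bounded_bound[OF C(1) *(1,2)] .
      then show ?thesis
        using *(3,4) dist_triangle[of x y x'] dist_triangle[of x' y y'] by (simp add: dist_commute)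
    qed
  qed (use s d in auto)
  then obtain I where I: "finite I" "1 \<le> c * (\<Sum>n\<in>I. d n powr s)" by (auto simp: c_def)
  have "(\<Sum>n\<in>I. (1 / 2 :: real) ^ Suc n) \<le> (\<Sum>n. (1 / 2) ^ Suc n)"
    using I(1) power_half_series by (intro sum_le_suminf) (auto simp: sums_iff)
  also have "\<dots> = 1" using power_half_series by (simp add: sums_iff)
  finally have half: "(\<Sum>n\<in>I. (1 / 2 :: real) ^ Suc n) \<le> 1" .
  have "1 / c \<le> (\<Sum>n\<in>I. d n powr s)" using I(2) c by (simp add: field_simps)
  also have "\<dots> \<le> (\<Sum>n\<in>I. diameter (C n) powr s + (1 / 2) ^ Suc n / (2 * c))"
    by (intro sum_mono d)
  also have "\<dots> = (\<Sum>n\<in>I. diameter (C n) powr s) + (\<Sum>n\<in>I. (1 / 2) ^ Suc n) / (2 * c)"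
    by (simp only: sum.distrib sum_divide_distrib)
  also have "\<dots> \<le> (\<Sum>n\<in>I. diameter (C n) powr s) + 1 / (2 * c)"
    using half c by (intro add_left_mono divide_right_mono) auto
  finally have "1 / (2 * c) \<le> (\<Sum>n\<in>I. diameter (C n) powr s)"
    by (simp add: field_simps)
  then have "ennreal (1 / (2 * c)) \<le> ennreal (\<Sum>n\<in>I. diameter (C n) powr s)" by (rule ennreal_leI)
  also have "\<dots> = (\<Sum>n\<in>I. ennreal (diameter (C n) powr s))" by (rule sum_ennreal[symmetric]) simp
  also have "\<dots> \<le> (\<Sum>n. ennreal (diameter (C n) powr s))"
    using I(1) by (intro sum_le_suminf) auto
  finally show ?thesis by (simp add: c_def)
qed

lemma hausdorff_outer_limit_set:
  assumes "0 \<le> s" "s < 2"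
  shows "hausdorff_outer s (limit_set g) \<noteq> 0"
proof -
  \<comment> \<open>The cover estimate wants a positive exponent, while \<open>s\<close> may be 0.
    Since the diameters are at most \<open>1 / 2\<close>, raising the exponent to \<open>r\<close>
    only decreases the sums.\<close>
  define r where "r = max s 1"
  have r: "0 < r" "r < 2" "s \<le> r" using assms by (auto simp: r_def)
  have "ennreal (1 / (200 * 2 powr (8 / (2 - r)\<^sup>2))) \<le> hausdorff_pre s (1 / 2) (limit_set g)"
    unfolding hausdorff_pre_def
  proof (rule INF_greatest, clarify)
    fix C :: "nat \<Rightarrow> (real \<times> real) set"
    assume C: "limit_set g \<subseteq> (\<Union>n. C n)" "\<forall>n. bounded (C n) \<and> diameter (C n) \<le> 1 / 2"
    then have "ennreal (1 / (200 * 2 powr (8 / (2 - r)\<^sup>2))) \<le> (\<Sum>n. ennreal (diameter (C n) powr r))"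
      using r by (intro cover_sum_ge) auto
    also have "\<dots> \<le> (\<Sum>n. ennreal (diameter (C n) powr s))"
    proof (intro suminf_le ennreal_leI)
      fix n
      have "0 \<le> diameter (C n)" "diameter (C n) \<le> 1"
        using C(2) diameter_ge_0 by (auto intro: order_trans[of _ "1 / 2"])
      then show "diameter (C n) powr r \<le> diameter (C n) powr s"
        using r by (intro powr_mono') auto
    qed auto
    finally show "ennreal (1 / (200 * 2 powr (8 / (2 - r)\<^sup>2))) \<le> (\<Sum>n. ennreal (diameter (C n) powr s))" .
  qed
  also have "\<dots> \<le> hausdorff_outer s (limit_set g)"
    unfolding hausdorff_outer_def by (intro SUP_upper) auto
  finally show ?thesis by (auto simp: ennreal_eq_0_iff)
qed

text \<open>Needed only because \<^const>\<open>hausdorff_dim\<close> is an infimum of reals, which is unspecified on the empty set.\<close>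

lemma hausdorff_outer_3_unit_square:
  fixes E :: "(real \<times> real) set"
  assumes E: "E \<subseteq> {0..1} \<times> {0..1}"
  shows "hausdorff_outer 3 E = 0"
proof -
  have bound: "hausdorff_pre 3 \<delta> E \<le> ennreal (8 / n)" if n: "n > 0" "2 / real n \<le> \<delta>" for n :: nat and \<delta>
  proof -
    define S where "S i = {real i / n..(real i + 1) / n}" for i
    \<comment> \<open>The \<open>n * n\<close> squares of side \<open>1 / n\<close> are numbered by
      quotient and remainder. The padding by empty sets contributes 0, so the sum is at most
      \<open>n ^ 2 * (2 / n) ^ 3 = 8 / n\<close>.\<close>
    define C where "C t = (if t < n * n then S (t div n) \<times> S (t mod n) else {})" for t
    have cover: "E \<subseteq> (\<Union>t. C t)"
    proof
      fix x assume "x \<in> E"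
      then have x: "0 \<le> fst x" "fst x \<le> 1" "0 \<le> snd x" "snd x \<le> 1" using E by auto
      have ex: "\<exists>i<n. u \<in> S i" if u: "0 \<le> u" "u \<le> 1" for u :: real
      proof (cases "u = 1")
        \<comment> \<open>The right endpoint goes to the last interval, since rounding down
          \<open>n * u\<close> would give the index \<open>n\<close>.\<close>
        case True
        then show ?thesis using n by (intro exI[of _ "n - 1"]) (auto simp: S_def of_nat_diff)
      next
        case False
        define i where "i = nat \<lfloor>n * u\<rfloor>"
        have "real i \<le> n * u" "n * u < real i + 1" using u n by (auto simp: i_def)
        moreover have "n * u < n" using False u n by auto
        ultimately have "real i < n" by linarith
        then show ?thesis using n \<open>real i \<le> n * u\<close> \<open>n * u < real i + 1\<close>
          by (intro exI[of _ i]) (auto simp: S_def field_simps)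
      qed
      obtain i j where ij: "i < n" "j < n" "fst x \<in> S i" "snd x \<in> S j" using ex x by metis
      have "i * n + j < Suc i * n" using ij by simp
      also have "\<dots> \<le> n * n" using ij by (intro mult_right_mono) auto
      finally have "x \<in> C (i * n + j)" using ij by (cases x) (auto simp: C_def)
      then show "x \<in> (\<Union>t. C t)" by blast
    qed
    have diam: "bounded (C t)" "diameter (C t) \<le> 2 / n" for t
    proof -
      have "dist x y \<le> 2 / n" if "x \<in> C t" "y \<in> C t" for x y
      proof -
        have *: "\<bar>a - b\<bar> \<le> 1 / n" if "a \<in> S i" "b \<in> S i" for a b i
          using that by (auto simp: S_def add_divide_distrib)
        have "dist x y \<le> \<bar>fst x - fst y\<bar> + \<bar>snd x - snd y\<bar>"
          by (cases x, cases y) (auto simp: dist_prod_def dist_real_def sqrt_sum_squares_le_sum_abs)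
        also have "\<dots> \<le> 1 / n + 1 / n"
          using that by (intro add_mono *) (auto simp: C_def split: if_splits)
        finally show ?thesis by simp
      qed
      then show "diameter (C t) \<le> 2 / n" by (intro diameter_le) (auto simp: dist_norm)
      show "bounded (C t)" by (auto simp: C_def S_def intro: bounded_Times)
    qed
    have "hausdorff_pre 3 \<delta> E \<le> (\<Sum>t. ennreal (diameter (C t) powr 3))"
      unfolding hausdorff_pre_def using cover diam n by (intro INF_lower) (auto intro: order_trans)
    also have "\<dots> = (\<Sum>t<n * n. ennreal (diameter (C t) powr 3))"
      by (intro suminf_finite) (auto simp: C_def)
    also have "\<dots> \<le> (\<Sum>t<n * n. ennreal ((2 / n) powr 3))"
      using diam by (intro sum_mono ennreal_leI powr_mono2 diameter_ge_0) auto
    also have "\<dots> = ennreal (\<Sum>t<n * n. (2 / n) powr 3)" by (rule sum_ennreal) auto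
    also have "(\<Sum>t<n * n. (2 / real n) powr 3) = 8 / n"
    proof -
      have "(2 / real n) powr 3 = (2 / real n) ^ 3" using n by (intro powr_numeral) auto
      also have "\<dots> = 8 / (real n * real n * real n)" by (simp add: power3_eq_cube)
      finally show ?thesis using n by simp
    qed
    finally show ?thesis .
  qed
  have small: "hausdorff_pre 3 \<delta> E \<le> 0 + ennreal e" if "\<delta> > 0" "e > 0" for \<delta> e
  proof -
    obtain n :: nat where n: "2 / \<delta> + 8 / e < n" using reals_Archimedean2 by auto
    have "2 / \<delta> > 0" "8 / e > 0" using that by auto
    with n have *: "real n > 0" "2 / \<delta> < n" "8 / e < n" by linarith+
    then have "8 / n \<le> e" "2 / n \<le> \<delta>" using that by (auto simp: field_simps)
    with bound[of n \<delta>] * show ?thesis by (auto intro: order_trans ennreal_leI)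
  qed
  have "hausdorff_pre 3 \<delta> E \<le> 0" if "\<delta> > 0" for \<delta>
    by (rule ennreal_le_epsilon) (rule small[OF that])
  then have "hausdorff_outer 3 E \<le> 0"
    unfolding hausdorff_outer_def by (intro SUP_least) simp
  then show ?thesis by simp
qed

lemma hausdorff_dim_limit_set: "hausdorff_dim (limit_set g) \<ge> 2"
  unfolding hausdorff_dim_def
proof (rule cInf_greatest)
  show "{s. 0 \<le> s \<and> hausdorff_outer s (limit_set g) = 0} \<noteq> {}"
    using hausdorff_outer_3_unit_square[OF limit_set_subset] by (intro ex_in_conv[THEN iffD1] exI[of _ 3]) auto
  show "2 \<le> s" if "s \<in> {s. 0 \<le> s \<and> hausdorff_outer s (limit_set g) = 0}" for s
    using that hausdorff_outer_limit_set[of s g] by (cases "s < 2") auto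
qed

section \<open>Differences and the polygonal norm\<close>

text \<open>The errors \<open>v - j\<close>, \<open>\<gamma> * (u - i)\<close> and the fractional
  part of \<open>\<gamma> * i\<close> lie in [0, 1], [-1, 1] and [0, 1), so their sum lies in [-1,
  3). Centring this range explains both the offset 1 and the radius 2.\<close>

lemma selected_skew:
  assumes h: "\<bar>snd h\<bar> \<le> 1" and t: "selected h p t" and x: "x \<in> square k t"
  shows "\<exists>z::int. \<bar>of_int (grid k) * skew h x - (of_int (p * z) + 1)\<bar> \<le> 2"
proof -
  define M where "M = real_of_int (grid k)"
  have M: "M > 0" using grid_pos by (simp add: M_def)
  have *: "\<bar>(v + \<gamma> * u) - (of_int (j + \<lfloor>\<gamma> * of_int i\<rfloor>) + 1)\<bar> \<le> 2"
    if "\<bar>\<gamma>\<bar> \<le> 1" "of_int i \<le> u" "u \<le> of_int i + 1" "of_int j \<le> v" "v \<le> of_int j + 1"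
    for u v \<gamma> :: real and i j :: int
  proof -
    have "\<bar>\<gamma> * (u - of_int i)\<bar> \<le> 1 * 1" unfolding abs_mult using that by (intro mult_mono) auto
    then have "\<bar>\<gamma> * u - \<gamma> * of_int i\<bar> \<le> 1" by (simp add: algebra_simps)
    moreover have "of_int \<lfloor>\<gamma> * of_int i\<rfloor> \<le> \<gamma> * of_int i" "\<gamma> * of_int i < of_int \<lfloor>\<gamma> * of_int i\<rfloor> + 1"
      by linarith+
    ultimately show ?thesis using that unfolding of_int_add by linarith
  qed
  have x': "of_int (fst t) \<le> M * fst x" "M * fst x \<le> of_int (fst t) + 1"
      "of_int (snd t) \<le> M * snd x" "M * snd x \<le> of_int (snd t) + 1"
    using x M unfolding square_def M_def[symmetric] by (auto simp: field_simps)
  show ?thesis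
  proof (cases "fst h")
    case True
    then obtain z where z: "snd t + \<lfloor>snd h * of_int (fst t)\<rfloor> = p * z"
      using t unfolding selected_def by (auto elim: dvdE)
    have "M * skew h x = M * snd x + snd h * (M * fst x)"
      using True by (simp add: skew_def algebra_simps)
    with *[OF h x'] z show ?thesis unfolding M_def by (intro exI[of _ z]) simp
  next
    case False
    then obtain z where z: "fst t + \<lfloor>snd h * of_int (snd t)\<rfloor> = p * z"
      using t unfolding selected_def by (auto elim: dvdE)
    have "M * skew h x = M * fst x + snd h * (M * snd x)"
      using False by (simp add: skew_def algebra_simps)
    with *[OF h x'(3,4,1,2)] z show ?thesis unfolding M_def by (intro exI[of _ z]) simp
  qed
qed

lemma skew_diff: "skew h (x - y) = skew h x - skew h y"
  by (simp add: skew_def algebra_simps)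

text \<open>The offset 1 cancels in differences, so \<open>M * skew (g k) (x - y)\<close> lies
  within 4 of a multiple of \<open>p\<close>. As \<open>skew (g k) (x - y)\<close> is at most 2 in
  absolute value, a number of intervals of order \<open>M / p\<close>, each of length
  \<open>8 / M\<close>, suffices, and \<open>M\<close> cancels.\<close>

lemma skew_differences_cover:
  assumes h: "\<bar>snd (g k)\<bar> \<le> 1"
  shows "\<exists>T \<in> lmeasurable. {skew (g k) (x - y) |x y. x \<in> limit_set g \<and> y \<in> limit_set g} \<subseteq> T
           \<and> measure lebesgue T \<le> 104 / 2 ^ k"
proof -
  define p :: int where "p = 2 ^ k"
  define M where "M = grid (Suc k)"
  have p: "p > 0" and M: "M > 0" using grid_pos by (auto simp: p_def M_def)
  have pM: "p \<le> M"
    unfolding p_def M_def grid_def by (intro power_increasing) (auto simp: power3_eq_cube)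
  \<comment> \<open>\<open>6 * M\<close> dominates the range \<open>2 * M + 4\<close> of the
    multiples since \<open>M >= 1\<close>. With \<open>p <= M\<close> there are at most
    \<open>13 * M / p\<close> balls, and \<open>13 * 8 = 104\<close>.\<close>
  define Z where "Z = 6 * M div p"
  define T where "T = (\<Union>z\<in>{-Z..Z}. cball (of_int (p * z) / of_int M) (4 / of_int M) :: real set)"
  have near: "\<exists>z::int. \<bar>of_int M * skew (g k) x - (of_int (p * z) + 1)\<bar> \<le> 2" if "x \<in> limit_set g" for x
  proof -
    have "x \<in> level g (Suc k)" using that by (auto simp: limit_set_def)
    then obtain t where "selected (g k) p t" "x \<in> square (Suc k) t"
      by (auto simp: level_def p_def)
    then show ?thesis unfolding M_def by (intro selected_skew h)
  qed
  have "skew (g k) (x - y) \<in> T" if xy: "x \<in> limit_set g" "y \<in> limit_set g" for x y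
  proof -
    obtain z w where z: "\<bar>of_int M * skew (g k) x - (of_int (p * z) + 1)\<bar> \<le> 2"
        and w: "\<bar>of_int M * skew (g k) y - (of_int (p * w) + 1)\<bar> \<le> 2"
      using near xy by metis
    define \<tau> where "\<tau> = skew (g k) (x - y)"
    have \<tau>: "\<bar>of_int M * \<tau> - of_int (p * (z - w))\<bar> \<le> 4"
      using z w by (simp add: \<tau>_def skew_diff algebra_simps)
    have "\<bar>fst (x - y)\<bar> \<le> 1" "\<bar>snd (x - y)\<bar> \<le> 1"
    proof -
      have "x \<in> {0..1} \<times> {0..1}" "y \<in> {0..1} \<times> {0..1}" using xy limit_set_subset by blast+
      then show "\<bar>fst (x - y)\<bar> \<le> 1" "\<bar>snd (x - y)\<bar> \<le> 1" by auto
    qed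
    moreover from this have "\<bar>snd (g k) * fst (x - y)\<bar> \<le> 1 * 1" "\<bar>snd (g k) * snd (x - y)\<bar> \<le> 1 * 1"
      unfolding abs_mult using h by (intro mult_mono; simp)+
    ultimately have "\<bar>\<tau>\<bar> \<le> 2" unfolding \<tau>_def skew_def by (cases "fst (g k)"; simp; linarith)
    then have "\<bar>of_int M * \<tau>\<bar> \<le> of_int M * 2" using M by (simp add: abs_mult)
    with \<tau> have "\<bar>real_of_int (p * (z - w))\<bar> \<le> of_int (2 * M + 4)" by simp
    then have "\<bar>p * (z - w)\<bar> \<le> 2 * M + 4" by linarith
    then have *: "\<bar>p * (z - w)\<bar> \<le> 6 * M" using M by linarith
    then have "(z - w) * p \<le> 6 * M" "(w - z) * p \<le> 6 * M" by (auto simp: algebra_simps)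
    then have "((z - w) * p) div p \<le> Z" "((w - z) * p) div p \<le> Z"
      unfolding Z_def using p by (intro zdiv_mono1; simp)+
    then have "z - w \<in> {-Z..Z}" using p by simp
    moreover have "\<tau> \<in> cball (of_int (p * (z - w)) / of_int M) (4 / of_int M)"
    proof -
      define a where "a = real_of_int (p * (z - w))"
      have "of_int M * \<tau> \<le> a + 4" "a - 4 \<le> of_int M * \<tau>" using \<tau> unfolding a_def by linarith+
      then have "\<tau> \<le> (a + 4) / of_int M" "(a - 4) / of_int M \<le> \<tau>"
        using M by (simp_all add: pos_le_divide_eq pos_divide_le_eq mult.commute)
      then show ?thesis
        unfolding a_def[symmetric] mem_cball dist_real_def add_divide_distrib diff_divide_distrib by linarith
    qed
    ultimately show ?thesis unfolding T_def \<tau>_def by blast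
  qed
  moreover have "T \<in> lmeasurable" unfolding T_def by (intro fmeasurable.finite_UN) auto
  moreover have "measure lebesgue T \<le> 104 / 2 ^ k"
  proof -
    have "measure lebesgue T \<le> (\<Sum>z\<in>{-Z..Z}. measure lebesgue (cball (of_int (p * z) / of_int M :: real) (4 / of_int M)))"
      unfolding T_def by (intro measure_UNION_le) auto
    also have "\<dots> = (\<Sum>z\<in>{-Z..Z}. 8 / of_int M)"
      using M by (intro sum.cong) (auto simp: cball_eq_atLeastAtMost)
    also have "\<dots> = of_int (2 * Z + 1) * (8 / of_int M)"
    proof -
      have "Z \<ge> 0" unfolding Z_def using p M by (simp add: pos_imp_zdiv_nonneg_iff)
      then show ?thesis by simp
    qed
    also have "\<dots> \<le> (13 * of_int M / of_int p) * (8 / of_int M)"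
    proof (intro mult_right_mono)
      have "Z * p \<le> 6 * M" unfolding Z_def
        using div_mult_mod_eq[of "6 * M" p] pos_mod_sign[OF p, of "6 * M"] by linarith
      then have "(2 * Z + 1) * p \<le> 13 * M" using pM by (simp add: algebra_simps)
      then have "real_of_int ((2 * Z + 1) * p) \<le> of_int (13 * M)" by linarith
      then show "real_of_int (2 * Z + 1) \<le> 13 * of_int M / of_int p" using p by (simp add: field_simps)
    qed (use M in auto)
    also have "\<dots> = 104 / 2 ^ k" using M by (simp add: p_def)
    finally show ?thesis .
  qed
  ultimately show ?thesis by (intro bexI[of _ T]) auto
qed

text \<open>Every occurrence of \<open>h\<close> in the sequence yields a cover of the same set;
  arbitrarily late occurrences make \<open>104 / 2 ^ k\<close> arbitrarily small.\<close>

lemma negligible_skew_differences: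
  assumes h: "\<bar>snd h\<bar> \<le> 1" and inf: "\<And>n. \<exists>k\<ge>n. g k = h"
  shows "negligible {skew h (x - y) |x y. x \<in> limit_set g \<and> y \<in> limit_set g}"
  unfolding negligible_outer
proof safe
  fix e :: real assume "e > 0"
  obtain n where n: "104 / e < 2 ^ n" using real_arch_pow[of 2 "104 / e"] by auto
  obtain k where k: "k \<ge> n" "g k = h" using inf by blast
  have "(2::real) ^ n \<le> 2 ^ k" using k by (intro power_increasing) auto
  with n have "104 / e < 2 ^ k" by linarith
  then have "104 / 2 ^ k < e" using \<open>e > 0\<close> by (simp add: field_simps)
  moreover obtain T where "T \<in> lmeasurable" "measure lebesgue T \<le> 104 / 2 ^ k"
      "{skew h (x - y) |x y. x \<in> limit_set g \<and> y \<in> limit_set g} \<subseteq> T"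
    using skew_differences_cover[of g k] h unfolding k(2) by blast
  ultimately show "\<exists>T. {skew h (x - y) |x y. x \<in> limit_set g \<and> y \<in> limit_set g} \<subseteq> T \<and> T \<in> lmeasurable
      \<and> measure lebesgue T < e" by (intro exI[of _ T]) simp
qed

section \<open>Norms whose unit ball is a polytope\<close>

lemma norm_polytope_functionals:
  fixes N :: "'a::euclidean_space \<Rightarrow> real"
  assumes N: "is_norm N" and poly: "polytope {x. N x \<le> 1}"
  shows "\<exists>A. finite A \<and> (\<forall>x. x \<noteq> 0 \<longrightarrow> (\<exists>a\<in>A. N x = a \<bullet> x))"
proof -
  have zero: "N x = 0 \<Longrightarrow> x = 0" and tri: "N (x + y) \<le> N x + N y"
    and scale: "N (c *\<^sub>R x) = \<bar>c\<bar> * N x" for x y c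
    using N unfolding is_norm_def by blast+
  have N0: "N 0 = 0" using scale[of 0 0] by simp
  have nonneg: "N x \<ge> 0" for x
    using tri[of x "- x"] scale[of "-1" x] N0 by simp
  obtain F where F: "finite F" "{x. N x \<le> 1} = \<Inter>F" "\<forall>h\<in>F. \<exists>a b. a \<noteq> 0 \<and> h = {x. a \<bullet> x \<le> b}"
    using polytope_imp_polyhedron[OF poly] unfolding polyhedron_def by (elim exE conjE) (rule that)
  obtain a b where ab: "\<And>h. h \<in> F \<Longrightarrow> a h \<noteq> 0 \<and> h = {x. a h \<bullet> x \<le> b h}"
    using F(3) by metis
  have ball: "N x \<le> 1 \<longleftrightarrow> (\<forall>h\<in>F. a h \<bullet> x \<le> b h)" for x
  proof -
    have "N x \<le> 1 \<longleftrightarrow> (\<forall>h\<in>F. x \<in> h)" using F(2) by blast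
    then show ?thesis using ab by blast
  qed
  \<comment> \<open>A small positive multiple of the normal \<open>a h\<close> lies in the unit
    ball, so the constraint at that point forces \<open>b h\<close> to be positive.\<close>
  have b_pos: "b h > 0" if h: "h \<in> F" for h
  proof -
    define e where "e = 1 / (N (a h) + 1)"
    have e: "e > 0" using nonneg[of "a h"] by (simp add: e_def)
    have "N (e *\<^sub>R a h) \<le> 1" using nonneg[of "a h"] by (simp add: scale e_def)
    then have "e * (a h \<bullet> a h) \<le> b h" using ball h by auto
    moreover have "e * (a h \<bullet> a h) > 0" using e ab[OF h] by simp
    ultimately show ?thesis by linarith
  qed
  \<comment> \<open>If no constraint were tight at \<open>u\<close>, the finitely many strict
    inequalities would survive stretching \<open>u\<close> by some factor \<open>1 + t > 1\<close>,
    although the stretched vector has norm above 1.\<close>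
  have active: "\<exists>h\<in>F. a h \<bullet> u = b h" if u: "N u = 1" for u
  proof (rule ccontr)
    assume "\<not> ?thesis"
    then have "\<forall>h\<in>F. a h \<bullet> u < b h" using ball[of u] u by force
    moreover have "\<forall>\<^sub>F t in at_right 0. a h \<bullet> ((1 + t) *\<^sub>R u) < b h" if "a h \<bullet> u < b h" for h
    proof (rule order_tendstoD(2))
      show "((\<lambda>t. a h \<bullet> ((1 + t) *\<^sub>R u)) \<longlongrightarrow> a h \<bullet> u) (at_right 0)"
        by (auto intro!: tendsto_eq_intros)
    qed (use that in auto)
    ultimately have "\<forall>\<^sub>F t in at_right 0. \<forall>h\<in>F. a h \<bullet> ((1 + t) *\<^sub>R u) < b h"
      using F(1) by (intro eventually_ball_finite) auto
    moreover have "\<forall>\<^sub>F t::real in at_right 0. 0 < t" by (rule eventually_at_right_less)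
    ultimately have "\<forall>\<^sub>F t::real in at_right 0. 0 < t \<and> N ((1 + t) *\<^sub>R u) \<le> 1"
      by eventually_elim (auto simp: ball intro: less_imp_le)
    then obtain t :: real where "0 < t" "N ((1 + t) *\<^sub>R u) \<le> 1"
      using eventually_happens'[of "at_right (0::real)"] trivial_limit_at_right_real by blast
    then show False using u by (simp add: scale)
  qed
  \<comment> \<open>Dividing a constraint tight at the normalised vector by \<open>b h\<close> gives
    the functional; homogeneity carries it from the unit sphere to \<open>x\<close>.\<close>
  have "\<exists>c\<in>(\<lambda>h. a h /\<^sub>R b h) ` F. N x = c \<bullet> x" if "x \<noteq> 0" for x
  proof -
    have pos: "N x > 0" using zero nonneg[of x] that by force
    then have "N (x /\<^sub>R N x) = 1" by (simp add: scale)
    then obtain h where h: "h \<in> F" "a h \<bullet> (x /\<^sub>R N x) = b h" using active by blast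
    then have "N x = (a h /\<^sub>R b h) \<bullet> x" using pos b_pos[OF h(1)] by (simp add: field_simps)
    then show ?thesis using h by blast
  qed
  then show ?thesis using F(1) by (intro exI[of _ "(\<lambda>h. a h /\<^sub>R b h) ` F"]) auto
qed

lemma inner_eq_skew:
  fixes v :: "real \<times> real"
  shows "\<exists>c h. \<bar>snd h\<bar> \<le> 1 \<and> (\<forall>x. v \<bullet> x = c * skew h x)"
proof (cases "\<bar>snd v\<bar> \<le> \<bar>fst v\<bar>")
  case True
  \<comment> \<open>For \<open>v = 0\<close> the slope is \<open>0 / 0 = 0\<close> and the factor
    \<open>fst v\<close> is 0, so this case is included.\<close>
  have "v \<bullet> x = fst v * skew (False, snd v / fst v) x" for x
    using True by (cases "fst v = 0") (simp_all add: skew_def inner_prod_def distrib_left)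
  moreover have "\<bar>snd v / fst v\<bar> \<le> 1"
    using True by (cases "fst v = 0") (simp_all add: abs_divide)
  ultimately show ?thesis by (metis snd_conv)
next
  case False
  then have "snd v \<noteq> 0" by auto
  then have "v \<bullet> x = snd v * skew (True, fst v / snd v) x" for x
    by (simp add: skew_def inner_prod_def distrib_left)
  moreover have "\<bar>fst v / snd v\<bar> \<le> 1"
    using False by (simp add: abs_divide)
  ultimately show ?thesis by (metis snd_conv)
qed

lemma ex_recurrent_sequence:
  assumes "finite H" "H \<noteq> {}"
  shows "\<exists>g :: nat \<Rightarrow> 'a. \<forall>h\<in>H. \<forall>n. \<exists>k\<ge>n. g k = h"
proof -
  obtain hs where hs: "set hs = H" using finite_list[OF assms(1)] by blast
  have "\<exists>k\<ge>n. hs ! (k mod length hs) = h" if h: "h \<in> H" for h n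
  proof -
    obtain i where i: "i < length hs" "hs ! i = h" using h unfolding hs[symmetric] in_set_conv_nth by blast
    then have "n * 1 \<le> n * length hs" by (intro mult_left_mono) auto
    then have "n \<le> i + n * length hs" by linarith
    then show ?thesis using i by (intro exI[of _ "i + n * length hs"]) auto
  qed
  then show ?thesis by (intro exI[of _ "\<lambda>k. hs ! (k mod length hs)"]) blast
qed

theorem theorem1:
  fixes K :: nat and N :: "real \<times> real \<Rightarrow> real"
  assumes "K \<ge> 2"
    and "is_norm N"
    and "polytope {x. N x \<le> 1}"
    and "card {F. F facet_of {x. N x \<le> 1}} = 2 * K"
  shows "\<exists>E. E \<subseteq> {0..1} \<times> {0..1}
             \<and> hausdorff_dim E \<ge> real K / (real K - 1)
             \<and> distance_set N E \<in> null_sets lebesgue"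
proof -
  obtain A where A: "finite A" "\<And>x. x \<noteq> 0 \<Longrightarrow> \<exists>a\<in>A. N x = a \<bullet> x"
    using norm_polytope_functionals assms(2,3) by blast
  obtain c :: "real \<times> real \<Rightarrow> real" and h where ch: "\<And>a. \<bar>snd (h a)\<bar> \<le> 1" "\<And>a x. a \<bullet> x = c a * skew (h a) x"
    using inner_eq_skew by metis
  have "A \<noteq> {}" using A(2)[of "(1, 0)"] by (auto simp: zero_prod_def)
  then have "\<exists>g :: nat \<Rightarrow> bool \<times> real. \<forall>s\<in>h ` A. \<forall>n. \<exists>k\<ge>n. g k = s"
    using A(1) by (intro ex_recurrent_sequence) auto
  then obtain g :: "nat \<Rightarrow> bool \<times> real" where "\<forall>s\<in>h ` A. \<forall>n. \<exists>k\<ge>n. g k = s" ..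
  then have g: "\<forall>a\<in>A. \<forall>n. \<exists>k\<ge>n. g k = h a" by blast
  define D where "D a = {skew (h a) (x - y) |x y. x \<in> limit_set g \<and> y \<in> limit_set g}" for a
  have "negligible (D a)" if "a \<in> A" for a
    unfolding D_def using ch(1) g that by (intro negligible_skew_differences) auto
  then have "negligible ((\<lambda>t. c a * t) ` D a)" if "a \<in> A" for a
    using that by (intro negligible_differentiable_image_negligible) (auto intro!: derivative_intros)
  \<comment> \<open>The point 0 accounts for pairs \<open>x = y\<close>, as \<open>A\<close>
    represents the norm only at nonzero vectors.\<close>
  then have "negligible ({0} \<union> (\<Union>a\<in>A. (\<lambda>t. c a * t) ` D a))"
    using A(1) by (intro negligible_Un negligible_sing negligible_Union) auto
  moreover have "distance_set N (limit_set g) \<subseteq> {0} \<union> (\<Union>a\<in>A. (\<lambda>t. c a * t) ` D a)"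
  proof
    fix r assume "r \<in> distance_set N (limit_set g)"
    then obtain x y where xy: "r = N (x - y)" "x \<in> limit_set g" "y \<in> limit_set g"
      by (auto simp: distance_set_def)
    show "r \<in> {0} \<union> (\<Union>a\<in>A. (\<lambda>t. c a * t) ` D a)"
    proof (cases "x = y")
      case True
      have "N (0 *\<^sub>R 0) = \<bar>0\<bar> * N 0" using assms(2) unfolding is_norm_def by blast
      then show ?thesis using True xy by simp
    next
      case False
      then obtain a where "a \<in> A" "r = c a * skew (h a) (x - y)" using A(2)[of "x - y"] ch(2) xy by auto
      then show ?thesis using xy unfolding D_def by blast
    qed
  qed
  ultimately have "distance_set N (limit_set g) \<in> null_sets lebesgue"
    using negligible_subset negligible_iff_null_sets by blast
  \<comment> \<open>For \<open>K >= 2\<close> the required dimension is at most 2, with equality at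
    \<open>K = 2\<close>.\<close>
  moreover have "real K / (real K - 1) \<le> 2" using assms(1) by (simp add: field_simps)
  then have "hausdorff_dim (limit_set g) \<ge> real K / (real K - 1)"
    using hausdorff_dim_limit_set order_trans by blast
  ultimately show ?thesis using limit_set_subset by blast
qed

end
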